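(* Let $\lambda_1,\lambda_2,\lambda_3\in\mathbb{C}$ and $\alpha,\beta,\gamma,\delta,\eta\in\mathbb{C}$ with $\Re(\alpha)>0$, $\Re(\beta)>0$, $\Re(\gamma)>0$, $\Re(\delta)>0$. Then $$\mathcal{L}\left\{ r^{\delta-1}E_{\alpha,\beta,\gamma,\delta}^{\eta}(\lambda_{1}r^{\alpha},\lambda_{2}r^{\beta},\lambda_{3}r^{\gamma})\right\}(s)=\frac{1}{s^{\delta}}\left(1-\frac{\lambda_{1}}{s^{\alpha}}-\frac{\lambda_{2}}{s^{\beta}}-\frac{\lambda_{3}}{s^{\gamma}}\right)^{-\eta},\qquad \Re(s)>0.$$
   Context: The trivariate Mittag-Leffler function is $$E_{\alpha,\beta,\gamma,\delta}^{\eta}(u,v,w)=\sum_{l=0}^{\infty}\sum_{p=0}^{\infty}\sum_{k=0}^{\infty}\frac{(\eta)_{l+p+k}}{\Gamma(l\alpha+p\beta+k\gamma+\delta)}\frac{u^l v^p w^k}{l!\,p!\,k!},$$ for $\alpha,\beta,\gamma,\delta,\eta\in\mathbb{C}$ with $\Re(\alpha),\Re(\beta),\Re(\gamma)>0$ and $u,v,w\in\mathbb{C}$. Here $(\eta)_n$ is the Pochhammer symbol, $(\eta)_0=1$, $(\eta)_n=\eta(\eta+1)\cdots(\eta+n-1)$ for $n\ge 1$, and $1/\Gamma$ is the reciprocal Gamma function (zero at the poles of $\Gamma$). The Laplace transform of a function $f$ of $r>0$ is $\mathcal{L}\{f(r)\}(s)=\int_0^\infty e^{-sr}f(r)\,d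r$.
   Formalization: Proved where Re(s)>0, the Laplace integral converges absolutely (shown for all large Re(s)), and either η is an integer with nonzero base or the base avoids (-∞,0] on the ray from s to infinity; for all Re(s)>0 it fails, e.g. e^r at s=1/2. Powers are principal values. *)

theory Defs
  imports "HOL-Analysis.Analysis"
begin

text \<open>The reciprocal Gamma function \<^const>\<open>rGamma\<close> is entire and vanishes at the poles of \<^const>\<open>Gamma\<close>.\<close>

definition trivariate_ML ::
  "complex \<Rightarrow> complex \<Rightarrow> complex \<Rightarrow> complex \<Rightarrow> complex \<Rightarrow> complex \<Rightarrow> complex \<Rightarrow> complex \<Rightarrow> complex"
  where "trivariate_ML \<alpha> \<beta> \<gamma> \<delta> \<eta> u v w =
    (\<Sum>l. \<Sum>p. \<Sum>k. pochhammer \<eta> (l + p + k)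
        * rGamma (of_nat l * \<alpha> + of_nat p * \<beta> + of_nat k * \<gamma> + \<delta>)
        * (u ^ l * v ^ p * w ^ k) / (fact l * fact p * fact k))"

text \<open>The Laplace integral is a Lebesgue integral. Since a divergent integral has a junk value in
  HOL, convergence at a point is recorded by a separate predicate.\<close>

definition laplace_converges :: "(real \<Rightarrow> complex) \<Rightarrow> complex \<Rightarrow> bool"
  where "laplace_converges f s \<longleftrightarrow>
    set_integrable lborel {0<..} (\<lambda>r. exp (- s * complex_of_real r) * f r)"

definition laplace_transform :: "(real \<Rightarrow> complex) \<Rightarrow> complex \<Rightarrow> complex"
  where "laplace_transform f s =
    set_lebesgue_integral lborel {0<..} (\<lambda>r. exp (- s * complex_of_real r) * f r)"

text \<open>For a function \<open>g\<close> on the right half-plane with \<open>g(ts)\<close> tending to \<open>1\<close> as \<open>t\<close> tends to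
  infinity, the power \<open>g(s)\<^sup>a\<close> has an unambiguous meaning as a principal value in two situations:
  for integer \<open>a\<close> (and \<open>g(s)\<close> nonzero) there is no choice of branch at all; otherwise the
  principal branch at \<open>s\<close> is the branch continued from \<open>1\<^sup>a = 1\<close> at infinity along the ray through
  \<open>s\<close>, provided \<open>g\<close> does not meet the cut on that ray. Without this proviso, e.g. for
  \<open>g(s) = (1 - c/s)\<^sup>2\<close> and \<open>a = -1/2\<close>, principal value and continued branch can differ by a sign.\<close>

definition principal_power_at :: "(complex \<Rightarrow> complex) \<Rightarrow> complex \<Rightarrow> complex \<Rightarrow> bool"
  where "principal_power_at g a s \<longleftrightarrow>
    (a \<in> \<int> \<and> g s \<noteq> 0) \<or> (\<forall>t\<ge>1. g (complex_of_real t * s) \<notin> \<real>\<^sub>\<le>\<^sub>0)"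

end

theory Submission
  imports Defs "HOL-Complex_Analysis.Complex_Analysis"
begin

text \<open>On the real axis far to the right, the triple series can be integrated term by term: in a
  sector around the positive real axis the quotient \<open>\<Gamma>(Re z) / |\<Gamma>(z)|\<close> grows at most exponentially
  in \<open>Re z\<close>, so the Laplace transforms of the absolute values of the terms are dominated by a
  trinomial series that converges there. The transformed terms add up, by the trinomial and
  the binomial theorem, to the right-hand side. At a general point \<open>s\<close> of absolute convergence the
  transform is holomorphic in \<open>Re z > Re s\<close> and continuous up to the boundary, so the identity
  theorem, applied on a domain that contains the ray from \<open>s\<close> to infinity, carries the formula
  back to \<open>s\<close>.\<close>

section \<open>Trinomial and binomial series\<close>

text \<open>Two uses of the binomial theorem: for fixed \<open>l\<close> the inner sum over
  \<open>p\<close>, with \<open>k = n - l - p\<close>, collapses to a power of \<open>b + c\<close>,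
  and the sum over \<open>l\<close> then collapses in the same way.\<close>

lemma trinomial_fact:
  fixes a b c :: "'a::field_char_0"
  shows "(\<Sum>(l, p, k) | l + p + k = n. a ^ l * b ^ p * c ^ k / (fact l * fact p * fact k))
    = (a + b + c) ^ n / fact n"
proof -
  have binom: "(\<Sum>i\<le>n. x ^ i * y ^ (n - i) / (fact i * fact (n - i))) = (x + y) ^ n / fact n"
    for x y :: 'a and n
    unfolding binomial_ring sum_divide_distrib
    by (intro sum.cong refl) (simp add: binomial_fact field_simps)
  have "(\<Sum>(l, p, k) | l + p + k = n. a ^ l * b ^ p * c ^ k / (fact l * fact p * fact k))
    = (\<Sum>(l, p)\<in>Sigma {..n} (\<lambda>l. {..n - l}).
        a ^ l / fact l * (b ^ p * c ^ (n - l - p) / (fact p * fact (n - l - p))))"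
    by (rule sum.reindex_bij_witness[where
          i = "\<lambda>(l, p). (l, p, n - l - p)" and j = "\<lambda>(l, p, k). (l, p)"]) (auto simp: mult.assoc)
  also have "\<dots> = (\<Sum>l\<le>n. a ^ l * (b + c) ^ (n - l) / (fact l * fact (n - l)))"
  proof (subst sum.Sigma[symmetric])
    show "(\<Sum>l\<le>n. \<Sum>p\<le>n - l. a ^ l / fact l * (b ^ p * c ^ (n - l - p) / (fact p * fact (n - l - p))))
      = (\<Sum>l\<le>n. a ^ l * (b + c) ^ (n - l) / (fact l * fact (n - l)))"
      by (intro sum.cong refl) (subst sum_distrib_left[symmetric], subst binom, simp)
  qed auto
  also have "\<dots> = (a + b + c) ^ n / fact n"
    by (simp add: binom add.assoc)
  finally show ?thesis .
qed

lemma finite_triples_sum: "finite {(l, p, k). l + p + k = (n::nat)}"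
  by (rule finite_subset[of _ "{..n} \<times> {..n} \<times> {..n}"]) auto

text \<open>Every triple lies in exactly one block of fixed total degree, so tagging it with its
  degree is a bijection. Sums over triples can thus be evaluated through finite blocks.\<close>

lemma has_sum_triples_grouped:
  fixes h :: "nat \<times> nat \<times> nat \<Rightarrow> 'a::{topological_comm_monoid_add, t3_space}"
  shows "(h has_sum S) UNIV \<longleftrightarrow>
    ((\<lambda>(n, x). h x) has_sum S) (Sigma UNIV (\<lambda>n. {(l, p, k). l + p + k = n}))"
  by (rule has_sum_reindex_bij_witness[where i = snd and j = "\<lambda>(l, p, k). (l + p + k, l, p, k)"])
     auto

text \<open>Nonnegative terms may be grouped freely: each finite block is summed by the trinomial
  identity, which leaves a single series in the degree \<open>n\<close>.\<close>

lemma summable_on_trinomial: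
  fixes F :: "nat \<Rightarrow> real"
  assumes "A \<ge> 0" "B \<ge> 0" "C \<ge> 0" "\<And>n. F n \<ge> 0"
    and "summable (\<lambda>n. F n * (A + B + C) ^ n / fact n)"
  shows "(\<lambda>(l, p, k). F (l + p + k) * (A ^ l * B ^ p * C ^ k) / (fact l * fact p * fact k))
    summable_on UNIV" (is "?h summable_on _")
proof -
  have "(\<lambda>(n, x). ?h x) summable_on (Sigma UNIV (\<lambda>n. {(l, p, k). l + p + k = n}))"
  proof (rule summable_on_SigmaI[where g = "\<lambda>n. F n * (A + B + C) ^ n / fact n"])
    show "((\<lambda>y. case (n, y) of (n, x) \<Rightarrow> ?h x) has_sum F n * (A + B + C) ^ n / fact n)
      {(l, p, k). l + p + k = n}" for n
    proof (rule has_sum_finiteI[OF finite_triples_sum])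
      have "F n * (A + B + C) ^ n / fact n = F n * ((A + B + C) ^ n / fact n)"
        by simp
      also have "\<dots> = (\<Sum>(l, p, k) | l + p + k = n.
          F (l + p + k) * (A ^ l * B ^ p * C ^ k) / (fact l * fact p * fact k))"
        unfolding trinomial_fact[symmetric] sum_distrib_left by (intro sum.cong) auto
      finally show "F n * (A + B + C) ^ n / fact n =
          (\<Sum>y | case y of (l, p, k) \<Rightarrow> l + p + k = n. case (n, y) of (n, x) \<Rightarrow> ?h x)"
        by simp
    qed
    show "(\<lambda>n. F n * (A + B + C) ^ n / fact n) summable_on UNIV"
      using assms by (intro summable_nonneg_imp_summable_on) auto
  qed (use assms in auto)
  then show ?thesis
    unfolding summable_on_def by (subst has_sum_triples_grouped) auto
qed

text \<open>The norms of the terms form a nonnegative series of the preceding kind. The resulting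
  absolute summability justifies grouping the complex terms by degree.\<close>

lemma has_sum_trinomial:
  fixes F :: "nat \<Rightarrow> complex"
  assumes "summable (\<lambda>n. norm (F n) * (norm a + norm b + norm c) ^ n / fact n)"
  shows "((\<lambda>(l, p, k). F (l + p + k) * (a ^ l * b ^ p * c ^ k) / (fact l * fact p * fact k))
    has_sum (\<Sum>n. F n * (a + b + c) ^ n / fact n)) UNIV" (is "(?h has_sum _) _")
proof -
  have norm_h: "norm (?h x) = (\<lambda>(l, p, k). norm (F (l + p + k)) *
      (norm a ^ l * norm b ^ p * norm c ^ k) / (fact l * fact p * fact k)) x" for x
    by (auto simp: norm_mult norm_divide norm_power split: prod.splits)
  have "?h summable_on UNIV"
    by (rule abs_summable_summable, unfold norm_h, rule summable_on_trinomial) (use assms in auto)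
  then have summable: "(\<lambda>(n, x). ?h x) summable_on (Sigma UNIV (\<lambda>n. {(l, p, k). l + p + k = n}))"
    unfolding summable_on_def by (subst (asm) has_sum_triples_grouped)
  have "((\<lambda>(n, x). ?h x) has_sum (\<Sum>n. F n * (a + b + c) ^ n / fact n))
    (Sigma UNIV (\<lambda>n. {(l, p, k). l + p + k = n}))"
  proof (rule has_sum_SigmaI[where g = "\<lambda>n. F n * (a + b + c) ^ n / fact n"])
    show "((\<lambda>y. case (n, y) of (n, x) \<Rightarrow> ?h x) has_sum F n * (a + b + c) ^ n / fact n)
      {(l, p, k). l + p + k = n}" for n
    proof (rule has_sum_finiteI[OF finite_triples_sum])
      have "F n * (a + b + c) ^ n / fact n = F n * ((a + b + c) ^ n / fact n)"
        by simp
      also have "\<dots> = (\<Sum>(l, p, k) | l + p + k = n.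
          F (l + p + k) * (a ^ l * b ^ p * c ^ k) / (fact l * fact p * fact k))"
        unfolding trinomial_fact[symmetric] sum_distrib_left by (intro sum.cong) auto
      finally show "F n * (a + b + c) ^ n / fact n =
          (\<Sum>y | case y of (l, p, k) \<Rightarrow> l + p + k = n. case (n, y) of (n, x) \<Rightarrow> ?h x)"
        by simp
    qed
    have "summable (\<lambda>n. norm (F n * (a + b + c) ^ n / fact n))"
    proof (rule summable_comparison_test'[OF assms])
      show "norm (norm (F n * (a + b + c) ^ n / fact n))
        \<le> norm (F n) * (norm a + norm b + norm c) ^ n / fact n" for n
        by (auto simp: norm_mult norm_divide norm_power intro!: divide_right_mono mult_left_mono
              power_mono order.trans[OF norm_triangle_ineq] add_mono)
    qed
    then show "((\<lambda>n. F n * (a + b + c) ^ n / fact n) has_sum (\<Sum>n. F n * (a + b + c) ^ n / fact n)) UNIV"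
      by (intro norm_summable_imp_has_sum summable_sums) (auto dest: summable_norm_cancel)
  qed (fact summable)
  then show ?thesis
    by (subst has_sum_triples_grouped)
qed

text \<open>This is the generalized binomial series with exponent \<open>- \<eta>\<close> at
  \<open>- X\<close>; the sign \<open>(-1) ^ n\<close> of the binomial coefficient cancels that of
  \<open>(- X) ^ n\<close>.\<close>

lemma binomial_series_pochhammer:
  fixes X :: complex
  assumes "norm X < 1"
  shows "(\<lambda>n. pochhammer \<eta> n * X ^ n / fact n) sums (1 - X) powr (- \<eta>)"
proof -
  have "((- \<eta>) gchoose n) * (- X) ^ n = pochhammer \<eta> n * X ^ n / fact n" for n
    by (simp add: gbinomial_pochhammer power_minus[of X] field_simps)
  with gen_binomial_complex[of "- X" "- \<eta>"] assms show ?thesis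
    by simp
qed

lemma norm_pochhammer_le: "norm (pochhammer z n) \<le> pochhammer (norm z) n"
  for z :: complex
  unfolding pochhammer_prod prod_norm[symmetric]
  by (intro prod_mono conjI norm_ge_zero order.trans[OF norm_triangle_ineq]) auto

text \<open>Replacing \<open>\<eta>\<close> by \<open>norm \<eta>\<close> gives a majorant, which is
  the binomial series of \<open>(1 - X) powr (- norm \<eta>)\<close>.\<close>

lemma summable_norm_pochhammer:
  assumes "0 \<le> X" "X < 1"
  shows "summable (\<lambda>n. norm (pochhammer \<eta> n :: complex) * X ^ n / fact n)"
proof -
  have "(\<lambda>n. complex_of_real (pochhammer (norm \<eta>) n * X ^ n / fact n))
    sums (1 - of_real X) powr (- of_real (norm \<eta>))"
    using binomial_series_pochhammer[of "of_real X" "of_real (norm \<eta>)"] assms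
    by (simp add: pochhammer_of_real)
  then have "summable (\<lambda>n. pochhammer (norm \<eta>) n * X ^ n / fact n)"
    by (metis sums_summable summable_complex_of_real)
  then show ?thesis
    by (rule summable_comparison_test')
       (auto intro!: divide_right_mono mult_right_mono norm_pochhammer_le simp: assms)
qed

section \<open>The Gamma function in a sector\<close>

text \<open>Each new term is at most a telescoping difference of reciprocals. The subtracted
  \<open>1 / (x + real n)\<close> is what carries the induction; it is dropped in the
  application.\<close>

lemma sum_inverse_squares_le:
  assumes "x > 0"
  shows "(\<Sum>i\<le>n. 1 / (x + real i)\<^sup>2) \<le> 1 / x\<^sup>2 + 1 / x - 1 / (x + real n)"
proof (induction n)
  case (Suc n)
  have "1 / (x + real (Suc n))\<^sup>2 \<le> 1 / ((x + real n) * (x + real (Suc n)))"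
    using assms by (auto simp: power2_eq_square intro!: divide_left_mono mult_right_mono mult_pos_pos)
  also have "\<dots> = 1 / (x + real n) - 1 / (x + real (Suc n))"
    using assms by (simp add: divide_simps)
  finally show ?case
    using Suc by simp
qed auto

text \<open>In a sector \<open>|Im z| \<le> M Re z\<close> the product formula bounds the ratio
  \<open>Gamma (Re z) / |Gamma z|\<close>, which is the square root of the product of all
  \<open>1 + (Im z)\<^sup>2 / (Re z + i)\<^sup>2\<close>.\<close>
lemma norm_rGamma_sector_le:
  assumes "Re z > 0" and "\<bar>Im z\<bar> \<le> M * Re z"
  shows "norm (rGamma z) * Gamma (Re z) \<le> exp (M\<^sup>2 * (1 + Re z) / 2)"
proof -
  define x y where "x = Re z" and "y = Im z"
  have x: "x > 0" and y: "\<bar>y\<bar> \<le> M * x"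
    using assms by (auto simp: x_def y_def)
  have y2: "y\<^sup>2 \<le> M\<^sup>2 * x\<^sup>2"
    using power_mono[OF y, of 2] by (simp add: power_mult_distrib)
  \<comment> \<open>The inequality \<open>1 + a \<le> exp a\<close> turns the product of these
    factors into the exponential of a sum of inverse squares.\<close>
  have factor: "norm (z + of_nat i) \<le> (x + real i) * exp (y\<^sup>2 / 2 * (1 / (x + real i)\<^sup>2))" for i
  proof -
    define u where "u = x + real i"
    have u: "u > 0" using x by (simp add: u_def)
    have "(norm (z + of_nat i))\<^sup>2 = u\<^sup>2 + y\<^sup>2"
      by (simp add: cmod_power2 u_def x_def y_def)
    also have "\<dots> = u\<^sup>2 * (1 + y\<^sup>2 / u\<^sup>2)"
      using u by (simp add: field_simps)
    also have "\<dots> \<le> u\<^sup>2 * exp (y\<^sup>2 / u\<^sup>2)"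
      by (intro mult_left_mono) auto
    also have "\<dots> = (u * exp (y\<^sup>2 / 2 * (1 / u\<^sup>2)))\<^sup>2"
    proof -
      have "y\<^sup>2 / u\<^sup>2 = 2 * (y\<^sup>2 / 2 * (1 / u\<^sup>2))"
        by simp
      then show ?thesis
        by (simp only: exp_double power_mult_distrib)
    qed
    finally have "norm (z + of_nat i) \<le> u * exp (y\<^sup>2 / 2 * (1 / u\<^sup>2))"
      by (rule power2_le_imp_le) (use u in simp)
    then show ?thesis
      by (simp only: u_def)
  qed
  have "norm (rGamma_series z n) \<le> exp (M\<^sup>2 * (1 + x) / 2) * rGamma_series x n" for n
  proof -
    have "norm (pochhammer z (n + 1)) \<le> (\<Prod>i\<le>n. (x + real i) * exp (y\<^sup>2 / 2 * (1 / (x + real i)\<^sup>2)))"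
      unfolding pochhammer_prod prod_norm[symmetric]
      using factor by (auto intro!: prod_mono simp: atLeast0AtMost lessThan_Suc_atMost atLeast0LessThan)
    also have "\<dots> = pochhammer x (n + 1) * exp (y\<^sup>2 / 2 * (\<Sum>i\<le>n. 1 / (x + real i)\<^sup>2))"
      by (simp add: prod.distrib pochhammer_prod exp_sum sum_distrib_left
           atLeast0LessThan lessThan_Suc_atMost del: prod.lessThan_Suc)
    also have "\<dots> \<le> pochhammer x (n + 1) * exp (M\<^sup>2 * (1 + x) / 2)"
    proof -
      \<comment> \<open>The factor \<open>x\<^sup>2\<close> from the sector condition cancels the
        inverse square, so the exponent becomes linear in \<open>x\<close>, uniformly in
        \<open>n\<close>.\<close>
      have "y\<^sup>2 / 2 * (\<Sum>i\<le>n. 1 / (x + real i)\<^sup>2) \<le> M\<^sup>2 * x\<^sup>2 / 2 * (1 / x\<^sup>2 + 1 / x)"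
      proof (intro mult_mono)
        have "1 / (x + real n) \<ge> 0" using x by simp
        then show "(\<Sum>i\<le>n. 1 / (x + real i)\<^sup>2) \<le> 1 / x\<^sup>2 + 1 / x"
          using sum_inverse_squares_le[OF x, of n] by linarith
      qed (use y2 in \<open>auto intro!: sum_nonneg\<close>)
      also have "\<dots> = M\<^sup>2 * (1 + x) / 2"
        using x by (simp add: field_simps power2_eq_square)
      finally show ?thesis
        using x by (intro mult_left_mono) (auto intro!: pochhammer_nonneg)
    qed
    finally have "norm (pochhammer z (n + 1)) \<le> pochhammer x (n + 1) * exp (M\<^sup>2 * (1 + x) / 2)" .
    then have "norm (pochhammer z (n + 1)) / (fact n * exp (x * ln (real n)))
      \<le> pochhammer x (n + 1) * exp (M\<^sup>2 * (1 + x) / 2) / (fact n * exp (x * ln (real n)))"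
      by (intro divide_right_mono) auto
    \<comment> \<open>The modulus of \<open>n\<close> to the power \<open>z\<close> depends only on
      \<open>Re z\<close>, so the series at \<open>z\<close> and at \<open>x\<close> share their
      denominators.\<close>
    moreover have "norm (rGamma_series z n) = norm (pochhammer z (n + 1)) / (fact n * exp (x * ln (real n)))"
      by (simp add: rGamma_series_def norm_divide norm_mult x_def)
    ultimately show ?thesis
      by (simp add: rGamma_series_def mult.commute)
  qed
  moreover have "(\<lambda>n. norm (rGamma_series z n)) \<longlonglongrightarrow> norm (rGamma z)"
    and "(\<lambda>n. exp (M\<^sup>2 * (1 + x) / 2) * rGamma_series x n) \<longlonglongrightarrow> exp (M\<^sup>2 * (1 + x) / 2) * rGamma x"
    by (intro tendsto_intros)+
  ultimately have "norm (rGamma z) \<le> exp (M\<^sup>2 * (1 + x) / 2) * rGamma x"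
    using LIMSEQ_le by blast
  then have "norm (rGamma z) * Gamma x \<le> exp (M\<^sup>2 * (1 + x) / 2) * rGamma x * Gamma x"
    using x by (intro mult_right_mono) (auto simp: Gamma_real_nonneg)
  also have "\<dots> = exp (M\<^sup>2 * (1 + x) / 2)"
    using Gamma_real_pos[OF x] by (simp add: rGamma_inverse_Gamma)
  finally show ?thesis
    by (simp add: x_def)
qed

section \<open>Analyticity of the Laplace transform\<close>

text \<open>The extra exponential has modulus at most 1 for \<open>r > 0\<close> and
  \<open>Re s \<le> Re z\<close>, so the integrand at \<open>s\<close> serves as the majorant in all
  limit arguments of this part.\<close>

lemma laplace_integrand_shift:
  "indicator {0<..} r *\<^sub>R (exp (- z * complex_of_real r) * f r) =
   exp (- (z - s) * of_real r) * (indicator {0<..} r *\<^sub>R (exp (- s * complex_of_real r) * f r))"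
proof -
  have "exp (- z * complex_of_real r) = exp (- (z - s) * of_real r) * exp (- s * complex_of_real r)"
    by (simp add: exp_add[symmetric] algebra_simps)
  then show ?thesis
    by simp
qed

lemma norm_laplace_shift_le:
  assumes "Re s \<le> Re z"
  shows "norm (indicator {0<..} r *\<^sub>R (exp (- z * complex_of_real r) * f r))
    \<le> norm (indicator {0<..} r *\<^sub>R (exp (- s * complex_of_real r) * f r))"
proof (cases "r > 0")
  case True
  have "norm (exp (- (z - s) * complex_of_real r)) \<le> 1"
    using assms True by (simp add: mult_nonpos_nonneg)
  then show ?thesis
    unfolding laplace_integrand_shift[of r z f s] norm_mult
    by (intro mult_left_le_one_le) auto
qed auto

lemma laplace_measurable:
  assumes "laplace_converges f s"
  shows "(\<lambda>r. indicator {0<..} r *\<^sub>R (exp (- z * complex_of_real r) * f r)) \<in> borel_measurable lborel"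
proof -
  note [measurable] = borel_measurable_integrable[OF assms[unfolded laplace_converges_def set_integrable_def]]
  show ?thesis
    unfolding laplace_integrand_shift[of _ z f s] by measurable
qed

lemma laplace_converges_mono:
  assumes "laplace_converges f s" "Re s \<le> Re z"
  shows "laplace_converges f z"
  unfolding laplace_converges_def set_integrable_def
  using assms norm_laplace_shift_le[OF assms(2)]
  by (intro Bochner_Integration.integrable_bound[OF assms(1)[unfolded laplace_converges_def set_integrable_def]]
      laplace_measurable[OF assms(1)]) auto

text \<open>Dominated convergence along sequences. The boundary line through \<open>s\<close> is
  included, which is needed to reach \<open>s\<close> itself as a limit.\<close>

lemma laplace_transform_continuous_on:
  assumes "laplace_converges f s"
  shows "continuous_on {z. Re s \<le> Re z} (laplace_transform f)"
  unfolding continuous_on_sequentially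
proof (intro allI ballI impI, elim conjE)
  fix u z assume u: "\<forall>n. u n \<in> {z. Re s \<le> Re z}" "u \<longlonglongrightarrow> z"
  show "(laplace_transform f \<circ> u) \<longlonglongrightarrow> laplace_transform f z"
    unfolding o_def laplace_transform_def set_lebesgue_integral_def
  proof (rule integral_dominated_convergence)
    show "integrable lborel (\<lambda>r. norm (indicator {0<..} r *\<^sub>R (exp (- s * complex_of_real r) * f r)))"
      using assms unfolding laplace_converges_def set_integrable_def by (rule integrable_norm)
    show "AE r in lborel. (\<lambda>n. indicator {0<..} r *\<^sub>R (exp (- u n * complex_of_real r) * f r))
      \<longlonglongrightarrow> indicator {0<..} r *\<^sub>R (exp (- z * complex_of_real r) * f r)"
      by (intro AE_I2 tendsto_intros u)
    show "AE r in lborel. norm (indicator {0<..} r *\<^sub>R (exp (- u n * complex_of_real r) * f r))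
      \<le> norm (indicator {0<..} r *\<^sub>R (exp (- s * complex_of_real r) * f r))" for n
      using u by (intro AE_I2 norm_laplace_shift_le) auto
  qed (intro laplace_measurable[OF assms])+
qed

text \<open>A mean value estimate on a convex half-plane: the derivative is at most
  \<open>r * exp (- d * r)\<close> in modulus, hence at most \<open>1 / d\<close>. That this bound
  is free of \<open>r\<close> makes it usable for dominated convergence.\<close>

lemma norm_exp_difference_quotient_le:
  assumes "d > 0" "r > 0" "Re s + d \<le> Re z" "Re s + d \<le> Re w"
  shows "norm (exp (- (w - s) * complex_of_real r) - exp (- (z - s) * of_real r)) \<le> 1 / d * norm (w - z)"
proof (rule field_differentiable_bound[where S = "{z. Re s + d \<le> Re z}"
      and f' = "\<lambda>v. - of_real r * exp (- (v - s) * of_real r)"])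
  show "convex {z. Re s + d \<le> Re z}"
    by (simp add: convex_halfspace_Re_ge)
  show "((\<lambda>v. exp (- (v - s) * complex_of_real r)) has_field_derivative
      - of_real r * exp (- (v - s) * of_real r)) (at v within {z. Re s + d \<le> Re z})" for v
    by (auto intro!: derivative_eq_intros)
  show "norm (- of_real r * exp (- (v - s) * of_real r)) \<le> 1 / d" if "v \<in> {z. Re s + d \<le> Re z}" for v
  proof -
    have "norm (- of_real r * exp (- (v - s) * of_real r)) = r * exp (- (Re v - Re s) * r)"
      using assms by (simp add: norm_mult)
    also have "\<dots> \<le> r * exp (- d * r)"
    proof -
      have "- (Re v - Re s) * r \<le> - d * r"
        using assms that by (intro mult_right_mono) auto
      then show ?thesis
        using assms by simp
    qed
    also have "\<dots> \<le> 1 / d"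
    proof -
      have "d * r \<le> exp (d * r)"
        using exp_ge_add_one_self[of "d * r"] by linarith
      then show ?thesis
        using assms by (simp add: exp_minus field_simps)
    qed
    finally show ?thesis .
  qed
qed (use assms in auto)

text \<open>Differentiation under the integral sign: the difference quotients are dominated by
  \<open>1 / d\<close> times the integrand at \<open>s\<close>.\<close>

lemma laplace_transform_holomorphic_on:
  assumes "laplace_converges f s"
  shows "laplace_transform f holomorphic_on {z. Re s < Re z}"
proof (rule holomorphic_onI)
  fix z assume "z \<in> {z. Re s < Re z}"
  \<comment> \<open>Half the distance to the boundary line, so that every point of
    \<open>ball z d\<close> still keeps the distance \<open>d\<close> from that line.\<close>
  define d where "d = (Re z - Re s) / 2"
  have d: "d > 0" "Re s + d \<le> Re z"
    using \<open>z \<in> _\<close> by (auto simp: d_def field_simps)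
  have ball: "Re s + d \<le> Re w" if "w \<in> ball z d" for w
  proof -
    have "\<bar>Re (z - w)\<bar> < d"
      using that by (intro le_less_trans[OF abs_Re_le_cmod]) (simp add: dist_norm)
    moreover have "2 * d = Re z - Re s"
      by (simp add: d_def)
    ultimately show ?thesis
      by simp
  qed
  define F where "F = (\<lambda>r. indicator {0<..} r *\<^sub>R (exp (- s * complex_of_real r) * f r))"
  have F: "integrable lborel F"
    using assms by (simp add: laplace_converges_def set_integrable_def F_def)
  note [measurable] = borel_measurable_integrable[OF F]
  define D where "D = (\<integral>r. - of_real r * exp (- (z - s) * of_real r) * F r \<partial>lborel)"
  have L: "laplace_transform f w = (\<integral>r. exp (- (w - s) * of_real r) * F r \<partial>lborel)" for w
    unfolding laplace_transform_def set_lebesgue_integral_def F_def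
    by (subst laplace_integrand_shift[of _ w f s]) simp
  have int: "integrable lborel (\<lambda>r. exp (- (w - s) * of_real r) * F r)" if "Re s \<le> Re w" for w
    using laplace_converges_mono[OF assms that]
    unfolding laplace_converges_def set_integrable_def laplace_integrand_shift[of _ w f s] F_def .
  have "((\<lambda>w. (laplace_transform f w - laplace_transform f z) / (w - z)) \<longlongrightarrow> D) (at z within ball z d)"
    unfolding tendsto_at_iff_sequentially o_def
  proof (intro allI impI)
    fix u assume u: "\<forall>n. u n \<in> ball z d - {z}" "u \<longlonglongrightarrow> z"
    have "(\<lambda>n. \<integral>r. (exp (- (u n - s) * of_real r) - exp (- (z - s) * of_real r)) / (u n - z) * F r \<partial>lborel)
       \<longlonglongrightarrow> D"
      unfolding D_def
    proof (rule integral_dominated_convergence)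
      show "integrable lborel (\<lambda>r. 1 / d * norm (F r))"
        using F by simp
      show "AE r in lborel. norm ((exp (- (u n - s) * of_real r) - exp (- (z - s) * of_real r)) / (u n - z) * F r)
          \<le> 1 / d * norm (F r)" for n
      proof (intro AE_I2)
        fix r :: real
        show "norm ((exp (- (u n - s) * of_real r) - exp (- (z - s) * of_real r)) / (u n - z) * F r)
          \<le> 1 / d * norm (F r)"
        proof (cases "r > 0")
          case True
          have "u n \<noteq> z" "Re s + d \<le> Re (u n)"
            using u ball by auto
          then have "norm ((exp (- (u n - s) * of_real r) - exp (- (z - s) * of_real r)) / (u n - z)) \<le> 1 / d"
            using norm_exp_difference_quotient_le[OF d(1) True d(2), of "u n"]
            by (simp add: norm_divide divide_le_eq)
          then show ?thesis
            unfolding norm_mult by (intro mult_right_mono) auto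
        qed (simp add: F_def)
      qed
      show "AE r in lborel. (\<lambda>n. (exp (- (u n - s) * of_real r) - exp (- (z - s) * of_real r)) / (u n - z) * F r)
          \<longlonglongrightarrow> - of_real r * exp (- (z - s) * of_real r) * F r"
      proof (intro AE_I2 tendsto_mult tendsto_const)
        fix r :: real
        have "((\<lambda>w. exp (- (w - s) * complex_of_real r)) has_field_derivative
            - of_real r * exp (- (z - s) * of_real r)) (at z within ball z d)"
          by (auto intro!: derivative_eq_intros)
        then show "(\<lambda>n. (exp (- (u n - s) * of_real r) - exp (- (z - s) * of_real r)) / (u n - z))
          \<longlonglongrightarrow> - of_real r * exp (- (z - s) * of_real r)"
          using u unfolding has_field_derivative_iff tendsto_at_iff_sequentially o_def by blast
      qed
    qed measurable
    moreover have "(\<integral>r. (exp (- (u n - s) * of_real r) - exp (- (z - s) * of_real r)) / (u n - z) * F r \<partial>lborel)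
      = (laplace_transform f (u n) - laplace_transform f z) / (u n - z)" for n
    proof -
      have "Re s \<le> Re (u n)" "Re s \<le> Re z"
        using ball[of "u n"] u d by force+
      then have "laplace_transform f (u n) - laplace_transform f z =
        (\<integral>r. exp (- (u n - s) * of_real r) * F r - exp (- (z - s) * of_real r) * F r \<partial>lborel)"
        unfolding L by (intro Bochner_Integration.integral_diff[symmetric] int)
      then show ?thesis
        by (simp add: left_diff_distrib diff_divide_distrib flip: Bochner_Integration.integral_divide_zero)
    qed
    ultimately show "(\<lambda>n. (laplace_transform f (u n) - laplace_transform f z) / (u n - z)) \<longlonglongrightarrow> D"
      by (simp only:)
  qed
  then have "(laplace_transform f has_field_derivative D) (at z within ball z d)"
    unfolding has_field_derivative_iff .
  then have "(laplace_transform f has_field_derivative D) (at z)"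
    using d(1) by (simp add: at_within_open[of z "ball z d"])
  then show "laplace_transform f field_differentiable at z within {z. Re s < Re z}"
    using field_differentiable_at_within field_differentiable_def by blast
qed

section \<open>Termwise Laplace transform\<close>

text \<open>Euler's integral for \<open>Gamma\<close>, transferred from the completed Lebesgue
  measure to \<open>lborel\<close>.\<close>

lemma laplace_powr_unit:
  assumes "Re z > 0"
  shows "laplace_converges (\<lambda>r. complex_of_real r powr (z - 1)) 1"
    and "laplace_transform (\<lambda>r. complex_of_real r powr (z - 1)) 1 = Gamma z"
proof -
  have "set_integrable lebesgue {0<..} (\<lambda>r. complex_of_real r powr (z - 1) / of_real (exp r))"
    using absolutely_integrable_Gamma_integral'[OF assms] .
  then have int: "set_integrable lborel {0<..} (\<lambda>r. complex_of_real r powr (z - 1) / of_real (exp r))"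
    unfolding set_integrable_def by (subst (asm) integrable_completion) auto
  have eq: "complex_of_real r powr (z - 1) / of_real (exp r) = exp (- 1 * of_real r) * of_real r powr (z - 1)"
    for r by (simp add: exp_minus field_simps exp_of_real)
  show "laplace_converges (\<lambda>r. complex_of_real r powr (z - 1)) 1"
    using int unfolding laplace_converges_def eq .
  have "laplace_transform (\<lambda>r. complex_of_real r powr (z - 1)) 1
      = integral {0<..} (\<lambda>r. complex_of_real r powr (z - 1) / of_real (exp r))"
    unfolding laplace_transform_def eq[symmetric] using int by (rule set_borel_integral_eq_integral)
  then show "laplace_transform (\<lambda>r. complex_of_real r powr (z - 1)) 1 = Gamma z"
    using Gamma_integral_complex'[OF assms] by (simp add: integral_unique)
qed

text \<open>The substitution of \<open>x * r\<close> for \<open>r\<close> reduces to the case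
  \<open>x = 1\<close>. For positive reals \<open>powr\<close> is multiplicative in the base, so no
  branch correction appears.\<close>

lemma laplace_powr_of_real:
  assumes "Re z > 0" "x > 0"
  shows "laplace_converges (\<lambda>r. complex_of_real r powr (z - 1)) (of_real x)"
    and "laplace_transform (\<lambda>r. complex_of_real r powr (z - 1)) (of_real x)
      = Gamma z * of_real x powr (- z)"
proof -
  define h where "h = (\<lambda>r. indicator {0<..} r *\<^sub>R (exp (- 1 * complex_of_real r) * of_real r powr (z - 1)))"
  have h: "integrable lborel h" "integral\<^sup>L lborel h = Gamma z"
    using laplace_powr_unit[OF assms(1)]
    by (simp_all add: laplace_converges_def laplace_transform_def set_integrable_def
        set_lebesgue_integral_def h_def)
  have scale: "indicator {0<..} r *\<^sub>R (exp (- of_real x * complex_of_real r) * of_real r powr (z - 1))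
      = of_real x powr (1 - z) * h (0 + x * r)" for r
  proof (cases "r > 0")
    case True
    then have "complex_of_real (x * r) powr (z - 1) = of_real x powr (z - 1) * of_real r powr (z - 1)"
      using assms by (simp add: powr_times_real)
    moreover have "complex_of_real x powr (1 - z) * of_real x powr (z - 1) = 1"
      using assms by (simp flip: powr_add)
    ultimately show ?thesis
      using True assms by (simp add: h_def)
  next
    case False
    then show ?thesis
      using assms by (simp add: h_def zero_less_mult_iff)
  qed
  show "laplace_converges (\<lambda>r. complex_of_real r powr (z - 1)) (of_real x)"
    unfolding laplace_converges_def set_integrable_def scale
    using assms by (intro integrable_mult_right lborel_integrable_real_affine h) auto
  have "laplace_transform (\<lambda>r. complex_of_real r powr (z - 1)) (of_real x)
      = of_real x powr (1 - z) * (\<integral>r. h (0 + x * r) \<partial>lborel)"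
    unfolding laplace_transform_def set_lebesgue_integral_def scale by simp
  also have "(\<integral>r. h (0 + x * r) \<partial>lborel) = Gamma z / x"
    using lborel_integral_real_affine[of x h 0] h assms by (simp add: field_simps scaleR_conv_of_real)
  also have "of_real x powr (1 - z) * (Gamma z / x) = Gamma z * of_real x powr (- z)"
    using assms by (simp add: powr_diff powr_minus field_simps)
  finally show "laplace_transform (\<lambda>r. complex_of_real r powr (z - 1)) (of_real x)
      = Gamma z * of_real x powr (- z)" .
qed

text \<open>Taking the modulus replaces \<open>z\<close> by \<open>Re z\<close> in the integrand.
  This is where the product of \<open>norm (rGamma z)\<close> and \<open>Gamma (Re z)\<close> in the
  later summability condition comes from.\<close>

lemma integral_norm_laplace_powr:
  assumes "Re z > 0" "x > 0"
  shows "(\<integral>r. norm (indicator {0<..} r *\<^sub>R (exp (- of_real x * complex_of_real r) * of_real r powr (z - 1))) \<partial>lborel)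
    = Gamma (Re z) * x powr (- Re z)" (is "?I = _")
proof -
  have "complex_of_real ?I = laplace_transform (\<lambda>r. complex_of_real r powr (of_real (Re z) - 1)) (of_real x)"
    unfolding laplace_transform_def set_lebesgue_integral_def integral_complex_of_real[symmetric]
  proof (intro Bochner_Integration.integral_cong refl)
    fix r :: real
    show "complex_of_real (norm (indicator {0<..} r *\<^sub>R (exp (- of_real x * complex_of_real r) * of_real r powr (z - 1))))
      = indicator {0<..} r *\<^sub>R (exp (- of_real x * complex_of_real r) * of_real r powr (of_real (Re z) - 1))"
    proof (cases "r > 0")
      case True
      then have "complex_of_real r powr (of_real (Re z) - 1) = of_real (r powr (Re z - 1))"
        using powr_of_real[of r "Re z - 1"] by simp
      moreover have "exp (- of_real x * complex_of_real r) = of_real (exp (- (x * r)))"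
        by (simp flip: exp_of_real)
      ultimately show ?thesis
        using True by (simp only: norm_scaleR norm_mult norm_powr_real_powr) (simp add: norm_powr_real_powr)
    qed simp
  qed
  also have "\<dots> = of_real (Gamma (Re z) * x powr (- Re z))"
    using assms by (subst laplace_powr_of_real)
      (auto simp: Gamma_complex_of_real powr_of_real simp flip: of_real_minus)
  finally show ?thesis
    by (simp only: of_real_eq_iff)
qed

text \<open>By monotone convergence the sum of the norms has a finite integral, so it is finite
  almost everywhere.\<close>

lemma AE_summable_norm:
  fixes f :: "nat \<Rightarrow> 'a \<Rightarrow> 'b::{banach, second_countable_topology}"
  assumes int: "\<And>i. integrable M (f i)" and sum: "summable (\<lambda>i. \<integral>x. norm (f i x) \<partial>M)"
  shows "AE x in M. summable (\<lambda>i. norm (f i x))"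
proof -
  note [measurable] = borel_measurable_integrable[OF int]
  have "(\<integral>\<^sup>+x. (\<Sum>i. ennreal (norm (f i x))) \<partial>M) = (\<Sum>i. \<integral>\<^sup>+x. ennreal (norm (f i x)) \<partial>M)"
    by (intro nn_integral_suminf) auto
  also have "\<dots> = (\<Sum>i. ennreal (\<integral>x. norm (f i x) \<partial>M))"
    using int by (intro suminf_cong nn_integral_eq_integral) auto
  also have "\<dots> = ennreal (\<Sum>i. \<integral>x. norm (f i x) \<partial>M)"
    using sum by (intro suminf_ennreal2) auto
  finally have "(\<integral>\<^sup>+x. (\<Sum>i. ennreal (norm (f i x))) \<partial>M) \<noteq> \<infinity>"
    by simp
  then have "AE x in M. (\<Sum>i. ennreal (norm (f i x))) \<noteq> \<infinity>"
    by (intro nn_integral_PInf_AE) auto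
  then show ?thesis
    by eventually_elim (auto intro: summable_suminf_not_top)
qed

text \<open>The last hypothesis says that the \<open>L^1\<close> norms of the terms are summable,
  which permits exchanging sum and integral. It also yields absolute convergence at almost every
  \<open>r\<close>, so \<open>f_eq\<close> may be restricted to such points and no pointwise
  convergence has to be established separately.\<close>

lemma laplace_power_series:
  fixes c z :: "nat \<Rightarrow> complex"
  assumes x: "x > 0" and z: "\<And>i. Re (z i) > 0"
    and f: "f \<in> borel_measurable borel"
    and f_eq: "\<And>r. r > 0 \<Longrightarrow> summable (\<lambda>i. norm (c i * rGamma (z i) * of_real r powr (z i - 1))) \<Longrightarrow>
      f r = (\<Sum>i. c i * rGamma (z i) * of_real r powr (z i - 1))"
    and summable: "summable (\<lambda>i. norm (c i) * (norm (rGamma (z i)) * Gamma (Re (z i))) * x powr (- Re (z i)))"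
  shows "laplace_converges f (of_real x)"
    and "laplace_transform f (of_real x) = (\<Sum>i. c i * of_real x powr (- z i))"
proof -
  define h where "h = (\<lambda>i r. indicator {0<..} r *\<^sub>R (exp (- of_real x * complex_of_real r) * of_real r powr (z i - 1)))"
  define G where "G = (\<lambda>i r. c i * rGamma (z i) * h i r)"
  have h: "integrable lborel (h i)" "integral\<^sup>L lborel (h i) = Gamma (z i) * of_real x powr (- z i)" for i
    using laplace_powr_of_real[OF z x]
    by (simp_all add: laplace_converges_def laplace_transform_def set_integrable_def
        set_lebesgue_integral_def h_def)
  have G: "integrable lborel (G i)" for i
    unfolding G_def by (intro integrable_mult_right h)
  have "(\<integral>r. norm (G i r) \<partial>lborel) = norm (c i) * (norm (rGamma (z i)) * Gamma (Re (z i))) * x powr (- Re (z i))"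
    for i
  proof -
    have "norm (G i r) = norm (c i) * norm (rGamma (z i)) * norm (h i r)" for r
      by (simp add: G_def norm_mult)
    moreover have "(\<integral>r. norm (h i r) \<partial>lborel) = Gamma (Re (z i)) * x powr (- Re (z i))"
      unfolding h_def by (rule integral_norm_laplace_powr[OF z x])
    ultimately show ?thesis
      by simp
  qed
  then have sum_G: "summable (\<lambda>i. \<integral>r. norm (G i r) \<partial>lborel)"
    using summable by simp
  have AE_G: "AE r in lborel. summable (\<lambda>i. norm (G i r))"
    by (rule AE_summable_norm[OF G sum_G])
  have f': "AE r in lborel. (\<Sum>i. G i r) = indicator {0<..} r *\<^sub>R (exp (- of_real x * complex_of_real r) * f r)"
    using AE_G
  proof eventually_elim
    case (elim r)
    show ?case
    proof (cases "r > 0")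
      case True
      have G_eq: "G i r = exp (- of_real x * complex_of_real r) * (c i * rGamma (z i) * of_real r powr (z i - 1))" for i
        using True by (simp add: G_def h_def)
      have "summable (\<lambda>i. norm (c i * rGamma (z i) * of_real r powr (z i - 1)))"
        using elim unfolding G_eq norm_mult[of "exp _"] by simp
      then show ?thesis
        using True f_eq[OF True] unfolding G_eq
        by (subst suminf_mult) (auto dest: summable_norm_cancel)
    qed (simp add: G_def h_def)
  qed
  have meas: "(\<lambda>r. indicator {0<..} r *\<^sub>R (exp (- of_real x * complex_of_real r) * f r)) \<in> borel_measurable lborel"
    using f by measurable
  show "laplace_converges f (of_real x)"
    unfolding laplace_converges_def set_integrable_def
    using integrable_suminf[OF G AE_G sum_G] meas f'
    by (rule integrable_cong_AE_imp)
  have "laplace_transform f (of_real x) = (\<integral>r. (\<Sum>i. G i r) \<partial>lborel)"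
    unfolding laplace_transform_def set_lebesgue_integral_def
    using f' borel_measurable_integrable[OF integrable_suminf[OF G AE_G sum_G]] meas
    by (intro integral_cong_AE) auto
  also have "\<dots> = (\<Sum>i. integral\<^sup>L lborel (G i))"
    by (rule integral_suminf[OF G AE_G sum_G])
  also have "\<dots> = (\<Sum>i. c i * of_real x powr (- z i))"
  proof (intro suminf_cong)
    fix i
    have "z i \<notin> \<int>\<^sub>\<le>\<^sub>0"
      using z[of i] by (auto elim!: nonpos_Ints_cases)
    then have "rGamma (z i) * Gamma (z i) = 1"
      by (simp add: rGamma_inverse_Gamma Gamma_eq_zero_iff)
    then have "c i * rGamma (z i) * (Gamma (z i) * of_real x powr (- z i)) = c i * of_real x powr (- z i)"
      by (simp add: mult.assoc[symmetric] mult.assoc[of "c i"])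
    then show "integral\<^sup>L lborel (G i) = c i * of_real x powr (- z i)"
      by (simp add: G_def h)
  qed
  finally show "laplace_transform f (of_real x) = (\<Sum>i. c i * of_real x powr (- z i))" .
qed

section \<open>Iterated series over triples and their enumeration as one series\<close>

lemma suminf_eq_infsum: "f summable_on UNIV \<Longrightarrow> suminf f = infsum f UNIV"
  for f :: "nat \<Rightarrow> complex"
  by (rule sums_unique[symmetric]) (intro has_sum_imp_sums has_sum_infsum)

lemma suminf_infsum_eq:
  fixes h :: "nat \<times> 'b \<Rightarrow> complex"
  assumes "h summable_on UNIV"
  shows "(\<Sum>l. infsum (\<lambda>y. h (l, y)) UNIV) = infsum h UNIV"
    and "(\<lambda>y. h (l, y)) summable_on UNIV"
proof -
  have h: "(\<lambda>(l, y). h (l, y)) summable_on (UNIV \<times> UNIV)"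
    using assms by simp
  show "(\<Sum>l. infsum (\<lambda>y. h (l, y)) UNIV) = infsum h UNIV"
    using suminf_eq_infsum[OF summable_on_Sigma_banach[OF h]] infsum_Sigma'_banach[OF h] by simp
  show "(\<lambda>y. h (l, y)) summable_on UNIV"
    using summable_on_SigmaD1[OF h] by simp
qed

text \<open>One index is split off at a time. Unconditional summability passes to every slice, so
  each inner \<open>suminf\<close> is a genuine sum and not a default value.\<close>

lemma suminf_triple_eq_infsum:
  fixes h :: "nat \<times> nat \<times> nat \<Rightarrow> complex"
  assumes "h summable_on UNIV"
  shows "(\<Sum>l. \<Sum>p. \<Sum>k. h (l, p, k)) = infsum h UNIV"
proof -
  have "(\<Sum>p. \<Sum>k. h (l, p, k)) = infsum (\<lambda>y. h (l, y)) UNIV" for l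
    using suminf_infsum_eq[of "\<lambda>y. h (l, y)"] suminf_infsum_eq(2)[OF assms]
    by (simp add: suminf_eq_infsum)
  then show ?thesis
    by (simp add: suminf_infsum_eq(1)[OF assms])
qed

text \<open>Termwise integration is formulated for sequences, so the triples are listed by the
  naturals; the order of the list is immaterial.\<close>

definition decode_triple :: "nat \<Rightarrow> nat \<times> nat \<times> nat"
  where "decode_triple n = apsnd prod_decode (prod_decode n)"

lemma bij_decode_triple: "bij decode_triple"
proof -
  have "bij (apsnd prod_decode :: nat \<times> nat \<Rightarrow> _)"
    by (rule o_bij[where g = "apsnd prod_encode"]) (auto simp: fun_eq_iff)
  then have "bij (apsnd prod_decode \<circ> prod_decode)"
    using bij_prod_decode by (rule bij_comp[rotated])
  then show ?thesis
    by (simp add: decode_triple_def[abs_def] o_def)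
qed

lemma has_sum_decode_triple: "((\<lambda>i. h (decode_triple i)) has_sum S) UNIV \<longleftrightarrow> (h has_sum S) UNIV"
  by (rule has_sum_reindex_bij_betw[OF bij_decode_triple])

lemma summable_on_decode_triple: "(\<lambda>i. h (decode_triple i)) summable_on UNIV \<longleftrightarrow> h summable_on UNIV"
  by (rule summable_on_reindex_bij_betw[OF bij_decode_triple])

lemma suminf_decode_triple:
  fixes h :: "nat \<times> nat \<times> nat \<Rightarrow> complex"
  assumes "summable (\<lambda>i. norm (h (decode_triple i)))"
  shows "(\<Sum>l. \<Sum>p. \<Sum>k. h (l, p, k)) = (\<Sum>i. h (decode_triple i))"
proof -
  have i: "(\<lambda>i. h (decode_triple i)) summable_on UNIV"
    using assms by (rule norm_summable_imp_summable_on)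
  show ?thesis
    using i infsum_reindex_bij_betw[OF bij_decode_triple, of h]
    by (simp add: suminf_triple_eq_infsum suminf_eq_infsum summable_on_decode_triple)
qed

section \<open>The transform on the real axis far to the right\<close>

lemma powr_linear_combination:
  fixes w a b c d :: complex
  assumes "w \<noteq> 0"
  shows "w powr (of_nat l * a + of_nat p * b + of_nat k * c + d) =
    w powr d * ((w powr a) ^ l * (w powr b) ^ p * (w powr c) ^ k)"
  using assms by (simp add: powr_add powr_power mult_ac)

lemma powr_linear_combination_real:
  assumes "w > (0::real)"
  shows "w powr (real l * a + real p * b + real k * c + d) =
    w powr d * ((w powr a) ^ l * (w powr b) ^ p * (w powr c) ^ k)"
  using assms by (simp add: powr_add powr_power mult_ac)

text \<open>The sector bound costs a factor exponential in the real part of the exponent, which can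
  be absorbed by enlarging \<open>1 / x\<close> to \<open>exp (M\<^sup>2 / 2) / x\<close>. The
  hypothesis \<open>small\<close> is then exactly the convergence condition for the majorizing
  trinomial series.\<close>

lemma laplace_trivariate_ML_of_real:
  fixes lam1 lam2 lam3 \<alpha> \<beta> \<gamma> \<delta> \<eta> :: complex
  assumes Re_pos: "Re \<alpha> > 0" "Re \<beta> > 0" "Re \<gamma> > 0" "Re \<delta> > 0"
    and sector: "\<bar>Im \<alpha>\<bar> \<le> M * Re \<alpha>" "\<bar>Im \<beta>\<bar> \<le> M * Re \<beta>" "\<bar>Im \<gamma>\<bar> \<le> M * Re \<gamma>" "\<bar>Im \<delta>\<bar> \<le> M * Re \<delta>"
    and x: "x > 0"
    and small: "norm lam1 * (exp (M\<^sup>2 / 2) / x) powr Re \<alpha> + norm lam2 * (exp (M\<^sup>2 / 2) / x) powr Re \<beta>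
      + norm lam3 * (exp (M\<^sup>2 / 2) / x) powr Re \<gamma> < 1"
  defines "f \<equiv> (\<lambda>r::real. complex_of_real r powr (\<delta> - 1)
            * trivariate_ML \<alpha> \<beta> \<gamma> \<delta> \<eta> (lam1 * complex_of_real r powr \<alpha>)
                (lam2 * complex_of_real r powr \<beta>) (lam3 * complex_of_real r powr \<gamma>))"
  shows "laplace_converges f (of_real x)"
    and "laplace_transform f (of_real x) = 1 / of_real x powr \<delta> *
      (1 - lam1 / of_real x powr \<alpha> - lam2 / of_real x powr \<beta> - lam3 / of_real x powr \<gamma>) powr (- \<eta>)"
proof -
  define q where "q = exp (M\<^sup>2 / 2) / x"
  define C where "C = (\<lambda>(l, p, k). pochhammer \<eta> (l + p + k) * (lam1 ^ l * lam2 ^ p * lam3 ^ k)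
    / (fact l * fact p * fact k))"
  define Z where "Z = (\<lambda>(l, p, k). of_nat l * \<alpha> + of_nat p * \<beta> + of_nat k * \<gamma> + \<delta>)"
  have q: "q > 0" using x by (simp add: q_def)
  have Z_pos: "Re (Z t) > 0" for t
    using Re_pos by (auto simp: Z_def intro!: add_nonneg_pos split: prod.splits)
  have Z_sector: "\<bar>Im (Z t)\<bar> \<le> M * Re (Z t)" for t
  proof -
    obtain l p k where t: "t = (l, p, k)" by (cases t)
    have "\<bar>Im (Z t)\<bar> \<le> real l * \<bar>Im \<alpha>\<bar> + real p * \<bar>Im \<beta>\<bar> + real k * \<bar>Im \<gamma>\<bar> + \<bar>Im \<delta>\<bar>"
      by (auto simp: Z_def t abs_mult intro!: order.trans[OF abs_triangle_ineq] add_mono)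
    also have "\<dots> \<le> real l * (M * Re \<alpha>) + real p * (M * Re \<beta>) + real k * (M * Re \<gamma>) + M * Re \<delta>"
      by (intro add_mono mult_left_mono sector) auto
    also have "\<dots> = M * Re (Z t)"
      by (simp add: Z_def t algebra_simps)
    finally show ?thesis .
  qed
  have f_eq: "f r = (\<Sum>i. C (decode_triple i) * rGamma (Z (decode_triple i)) * of_real r powr (Z (decode_triple i) - 1))"
    if r: "r > 0" and sum: "summable (\<lambda>i. norm (C (decode_triple i) * rGamma (Z (decode_triple i))
      * complex_of_real r powr (Z (decode_triple i) - 1)))" for r
  proof -
    define w where "w = complex_of_real r powr (\<delta> - 1)"
    define h where "h = (\<lambda>(l, p, k). pochhammer \<eta> (l + p + k)
        * rGamma (of_nat l * \<alpha> + of_nat p * \<beta> + of_nat k * \<gamma> + \<delta>)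
        * ((lam1 * complex_of_real r powr \<alpha>) ^ l * (lam2 * complex_of_real r powr \<beta>) ^ p
          * (lam3 * complex_of_real r powr \<gamma>) ^ k) / (fact l * fact p * fact k))"
    have wh: "C t * rGamma (Z t) * of_real r powr (Z t - 1) = w * h t" for t
    proof -
      obtain l p k where t: "t = (l, p, k)" by (cases t)
      have "complex_of_real r powr (Z t - 1) = of_real r powr (of_nat l * \<alpha> + of_nat p * \<beta> + of_nat k * \<gamma> + (\<delta> - 1))"
        by (simp add: Z_def t algebra_simps)
      also have "\<dots> = w * ((of_real r powr \<alpha>) ^ l * (of_real r powr \<beta>) ^ p * (of_real r powr \<gamma>) ^ k)"
        unfolding w_def using r by (intro powr_linear_combination) auto
      finally show ?thesis
        by (simp add: C_def h_def Z_def t power_mult_distrib mult_ac)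
    qed
    \<comment> \<open>Dividing by the common factor \<open>w\<close> transfers absolute convergence
      to \<open>h\<close>, so that the iterated sums may be replaced by the enumerated one.\<close>
    have "w \<noteq> 0"
      using r by (simp add: w_def)
    then have sum_h: "summable (\<lambda>i. norm (h (decode_triple i)))"
      using sum unfolding wh norm_mult by simp
    have "f r = w * (\<Sum>l. \<Sum>p. \<Sum>k. h (l, p, k))"
      by (simp add: f_def w_def h_def trivariate_ML_def)
    also have "\<dots> = w * (\<Sum>i. h (decode_triple i))"
      by (simp only: suminf_decode_triple[OF sum_h])
    also have "\<dots> = (\<Sum>i. w * h (decode_triple i))"
      using sum_h by (intro suminf_mult[symmetric]) (rule summable_norm_cancel)
    finally show ?thesis
      by (simp only: wh)
  qed
  have f_meas: "f \<in> borel_measurable borel"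
    unfolding f_def trivariate_ML_def by measurable
  have summable: "summable (\<lambda>i. norm (C (decode_triple i)) * (norm (rGamma (Z (decode_triple i)))
      * Gamma (Re (Z (decode_triple i)))) * x powr (- Re (Z (decode_triple i))))"
  proof (rule summable_comparison_test')
    define h where "h = (\<lambda>(l, p, k). norm (pochhammer \<eta> (l + p + k)) *
      ((norm lam1 * q powr Re \<alpha>) ^ l * (norm lam2 * q powr Re \<beta>) ^ p * (norm lam3 * q powr Re \<gamma>) ^ k)
      / (fact l * fact p * fact k))"
    have "h summable_on UNIV"
      unfolding h_def using small by (intro summable_on_trinomial summable_norm_pochhammer) (auto simp: q_def)
    then have "summable (\<lambda>i. h (decode_triple i))"
      by (intro summable_on_imp_summable) (simp only: summable_on_decode_triple)
    then show "summable (\<lambda>i. exp (M\<^sup>2 / 2) * q powr Re \<delta> * h (decode_triple i))"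
      by (rule summable_mult)
    have "norm (C t) * (norm (rGamma (Z t)) * Gamma (Re (Z t))) * x powr (- Re (Z t))
      \<le> exp (M\<^sup>2 / 2) * q powr Re \<delta> * h t" for t
    proof -
      obtain l p k where t: "t = (l, p, k)" by (cases t)
      have "norm (C t) * (norm (rGamma (Z t)) * Gamma (Re (Z t))) * x powr (- Re (Z t))
        \<le> norm (C t) * exp (M\<^sup>2 * (1 + Re (Z t)) / 2) * x powr (- Re (Z t))"
        by (intro mult_left_mono mult_right_mono norm_rGamma_sector_le Z_pos Z_sector) auto
      also have "exp (M\<^sup>2 * (1 + Re (Z t)) / 2) = exp (M\<^sup>2 / 2) * exp (M\<^sup>2 / 2) powr Re (Z t)"
        by (simp add: powr_def add_divide_distrib ring_distribs flip: exp_add)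
      also have "norm (C t) * (exp (M\<^sup>2 / 2) * exp (M\<^sup>2 / 2) powr Re (Z t)) * x powr (- Re (Z t))
        = exp (M\<^sup>2 / 2) * norm (C t) * q powr Re (Z t)"
        using x by (simp add: q_def powr_divide powr_minus_divide)
      also have "q powr Re (Z t) = q powr Re \<delta> * ((q powr Re \<alpha>) ^ l * (q powr Re \<beta>) ^ p * (q powr Re \<gamma>) ^ k)"
        using powr_linear_combination_real[OF q] by (simp add: Z_def t)
      finally show ?thesis
        by (simp add: C_def h_def t norm_mult norm_divide norm_power power_mult_distrib mult_ac)
    qed
    then show "norm (norm (C (decode_triple i)) * (norm (rGamma (Z (decode_triple i)))
      * Gamma (Re (Z (decode_triple i)))) * x powr (- Re (Z (decode_triple i))))
      \<le> exp (M\<^sup>2 / 2) * q powr Re \<delta> * h (decode_triple i)" for i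
      using Gamma_real_pos[OF Z_pos[of "decode_triple i"]] by simp
  qed
  show "laplace_converges f (of_real x)"
    by (rule laplace_power_series(1)[OF x Z_pos f_meas f_eq summable])
  define a b c where "a = lam1 / of_real x powr \<alpha>" and "b = lam2 / of_real x powr \<beta>"
    and "c = lam3 / of_real x powr \<gamma>"
  \<comment> \<open>Since \<open>exp (M\<^sup>2 / 2)\<close> is at least 1, \<open>q\<close> is at
    least \<open>1 / x\<close>; hence \<open>small\<close> also provides convergence of the binomial
    series in \<open>a + b + c\<close>.\<close>
  have le_q: "norm (y / complex_of_real x powr u) \<le> norm y * q powr Re u" if "Re u > 0" for y u
  proof -
    have "norm (y / complex_of_real x powr u) = norm y * (1 / x) powr Re u"
      using x by (simp add: norm_divide norm_powr_real_powr powr_divide)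
    also have "\<dots> \<le> norm y * q powr Re u"
      using x that by (intro mult_left_mono powr_mono2) (auto simp: q_def divide_right_mono)
    finally show ?thesis .
  qed
  have abc: "norm a + norm b + norm c < 1"
    using le_q[OF Re_pos(1), of lam1] le_q[OF Re_pos(2), of lam2] le_q[OF Re_pos(3), of lam3] small
    unfolding a_def b_def c_def q_def by linarith
  then have "norm (a + b + c) < 1"
    by (meson norm_triangle_ineq add_right_mono order.trans order.strict_trans1)
  then have "(\<Sum>n. pochhammer \<eta> n * (a + b + c) ^ n / fact n) = (1 - (a + b + c)) powr (- \<eta>)"
    using binomial_series_pochhammer sums_unique by metis
  then have tri: "((\<lambda>(l, p, k). pochhammer \<eta> (l + p + k) * (a ^ l * b ^ p * c ^ k) / (fact l * fact p * fact k))
      has_sum (1 - (a + b + c)) powr (- \<eta>)) UNIV"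
    using has_sum_trinomial[of "pochhammer \<eta>" a b c] summable_norm_pochhammer[OF _ abc, of \<eta>] by simp
  have "C t * of_real x powr (- Z t) = 1 / of_real x powr \<delta> * (\<lambda>(l, p, k). pochhammer \<eta> (l + p + k) *
      (a ^ l * b ^ p * c ^ k) / (fact l * fact p * fact k)) t" for t
  proof -
    obtain l p k where t: "t = (l, p, k)" by (cases t)
    have "complex_of_real x powr (- Z t) = 1 / of_real x powr (Z t)"
      by (simp add: powr_minus divide_inverse)
    also have "of_real x powr (Z t) = of_real x powr \<delta> *
        ((of_real x powr \<alpha>) ^ l * (of_real x powr \<beta>) ^ p * (of_real x powr \<gamma>) ^ k)"
      unfolding Z_def t using x by (simp add: powr_linear_combination)
    finally show ?thesis
      by (simp add: C_def t a_def b_def c_def power_divide)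
  qed
  then have "((\<lambda>t. C t * of_real x powr (- Z t)) has_sum 1 / of_real x powr \<delta> * (1 - (a + b + c)) powr (- \<eta>)) UNIV"
    using has_sum_cmult_right[OF tri, of "1 / of_real x powr \<delta>"] by (simp only:)
  then have "((\<lambda>i. C (decode_triple i) * of_real x powr (- Z (decode_triple i)))
      has_sum 1 / of_real x powr \<delta> * (1 - (a + b + c)) powr (- \<eta>)) UNIV"
    by (subst has_sum_decode_triple[where h = "\<lambda>t. C t * of_real x powr (- Z t)"])
  then have "(\<Sum>i. C (decode_triple i) * of_real x powr (- Z (decode_triple i)))
      = 1 / of_real x powr \<delta> * (1 - (a + b + c)) powr (- \<eta>)"
    by (intro sums_unique[symmetric] has_sum_imp_sums)
  then show "laplace_transform f (of_real x) = 1 / of_real x powr \<delta> *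
      (1 - lam1 / of_real x powr \<alpha> - lam2 / of_real x powr \<beta> - lam3 / of_real x powr \<gamma>) powr (- \<eta>)"
    using laplace_power_series(2)[OF x Z_pos f_meas f_eq summable]
    by (simp add: a_def b_def c_def diff_diff_eq)
qed

section \<open>Decay of the subtracted terms far to the right\<close>

lemma ex_bound_sum_powr_less_one:
  assumes "K \<ge> 0" "u > 0" "v > 0" "w > (0::real)"
  shows "\<exists>X>0. \<forall>x>X. A * (K / x) powr u + B * (K / x) powr v + C * (K / x) powr w < 1"
proof -
  have lim: "((\<lambda>x. (K / x) powr u) \<longlongrightarrow> 0) at_top" if "u > 0" for u
  proof -
    have "((\<lambda>x. K powr u * x powr (- u)) \<longlongrightarrow> K powr u * 0) at_top"
      using that by (intro tendsto_mult tendsto_const tendsto_neg_powr filterlim_ident) auto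
    moreover have "eventually (\<lambda>x. K powr u * x powr (- u) = (K / x) powr u) at_top"
      using eventually_gt_at_top[of 0]
      by eventually_elim (use assms in \<open>simp add: powr_divide powr_minus_divide\<close>)
    ultimately show ?thesis
      using Lim_transform_eventually by fastforce
  qed
  have "((\<lambda>x. A * (K / x) powr u + B * (K / x) powr v + C * (K / x) powr w) \<longlongrightarrow> A * 0 + B * 0 + C * 0) at_top"
    by (intro tendsto_intros lim assms)
  then have "eventually (\<lambda>x. A * (K / x) powr u + B * (K / x) powr v + C * (K / x) powr w < 1) at_top"
    by (rule order_tendstoD) simp
  then obtain X where X: "\<And>x. x > X \<Longrightarrow> A * (K / x) powr u + B * (K / x) powr v + C * (K / x) powr w < 1"
    unfolding eventually_at_top_dense by blast
  then show ?thesis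
    by (intro exI[of _ "max X 1"]) auto
qed

text \<open>The modulus of \<open>s powr a\<close> differs from \<open>norm s powr Re a\<close> by a
  factor governed by \<open>Im a\<close> times the argument of \<open>s\<close>. The argument is at
  most \<open>pi\<close> in modulus, so the sector condition lets \<open>exp (M * pi)\<close> absorb
  that factor.\<close>

lemma norm_divide_powr_le:
  assumes "s \<noteq> 0" "Re a > 0" "\<bar>Im a\<bar> \<le> M * Re a"
  shows "norm (y / s powr a) \<le> norm y * (exp (M * pi) / norm s) powr Re a"
proof -
  have "Im a * Im (Ln s) \<le> \<bar>Im a\<bar> * \<bar>Im (Ln s)\<bar>"
    by (metis abs_ge_self abs_mult)
  also have "\<dots> \<le> (M * Re a) * pi"
    using assms mpi_less_Im_Ln[of s] Im_Ln_le_pi[of s] by (intro mult_mono) auto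
  finally have "- Re (a * Ln s) \<le> Re a * (M * pi - ln (norm s))"
    using assms by (simp add: algebra_simps)
  then have "inverse (norm (s powr a)) \<le> exp (Re a * (M * pi - ln (norm s)))"
    using assms by (simp add: powr_def flip: exp_minus)
  also have "\<dots> = (exp (M * pi) / norm s) powr Re a"
    using assms by (simp add: powr_def ln_div)
  finally show ?thesis
    unfolding divide_inverse norm_mult norm_inverse by (rule mult_left_mono) simp
qed

section \<open>Analytic continuation along rays\<close>

lemma norm_less_one_imp_not_nonpos_Reals:
  assumes "norm (1 - z :: complex) < 1"
  shows "z \<notin> \<real>\<^sub>\<le>\<^sub>0"
  using assms complex_Re_le_cmod[of "1 - z"] by (auto simp: complex_nonpos_Reals_iff)

text \<open>Supplies the accumulation point of zeros for the identity theorem.\<close>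

lemma of_real_islimpt: "complex_of_real (a + 1) islimpt complex_of_real ` {a<..}"
  unfolding islimpt_approachable
proof (intro allI impI)
  fix e :: real assume "e > 0"
  then show "\<exists>x'\<in>complex_of_real ` {a<..}. x' \<noteq> of_real (a + 1) \<and> dist x' (of_real (a + 1)) < e"
    by (intro bexI[of _ "of_real (a + 1 + e / 2)"]) (auto simp: dist_norm simp flip: of_real_diff of_real_add)
qed

text \<open>The difference of the two sides vanishes on a real half-line, hence on \<open>S\<close>
  by the identity theorem. As \<open>s\<close> lies on the boundary of the half-plane of holomorphy,
  it is reached only by continuity along the ray. Keeping \<open>G\<close> as a factor on the left
  allows it to have zeros.\<close>

lemma laplace_transform_identity_ray:
  assumes conv: "laplace_converges f s" and "Re s > 0"
    and S: "open S" "connected S" "S \<subseteq> {z. Re s < Re z}"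
    and real_S: "\<And>x. x > \<sigma> \<Longrightarrow> complex_of_real x \<in> S"
    and ray_S: "\<And>t. t > 1 \<Longrightarrow> complex_of_real t * s \<in> S"
    and GH: "G holomorphic_on T" "H holomorphic_on T" "insert s S \<subseteq> T"
    and eq: "\<And>x. x > \<sigma> \<Longrightarrow> laplace_transform f (of_real x) * G (of_real x) = H (of_real x)"
  shows "laplace_transform f s * G s = H s"
proof -
  define D where "D = (\<lambda>z. laplace_transform f z * G z - H z)"
  have D_S: "D z = 0" if "z \<in> S" for z
  proof (rule analytic_continuation[of D S "of_real ` {\<sigma><..}" "of_real (\<sigma> + 1)"])
    show "D holomorphic_on S"
      unfolding D_def using S GH
      by (intro holomorphic_intros holomorphic_on_subset[OF laplace_transform_holomorphic_on[OF conv]]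
          holomorphic_on_subset[OF GH(1)] holomorphic_on_subset[OF GH(2)]) auto
  qed (use S real_S real_S[of "\<sigma> + 1"] eq that of_real_islimpt in \<open>auto simp: D_def\<close>)
  have ray: "complex_of_real t * s \<in> T" if "t \<ge> 1" for t
    using ray_S[of t] GH(3) that by (cases "t = 1") auto
  have "continuous_on {1..} (\<lambda>t. D (of_real t * s))"
  proof (rule continuous_on_compose2[of "T \<inter> {z. Re s \<le> Re z}" D])
    show "continuous_on (T \<inter> {z. Re s \<le> Re z}) D"
      unfolding D_def using GH
      by (intro continuous_intros continuous_on_subset[OF laplace_transform_continuous_on[OF conv]]
          continuous_on_subset[OF holomorphic_on_imp_continuous_on[of _ T]]) auto
    show "(\<lambda>t. complex_of_real t * s) ` {1..} \<subseteq> T \<inter> {z. Re s \<le> Re z}"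
      using ray \<open>Re s > 0\<close> by auto
  qed (intro continuous_intros)
  \<comment> \<open>The parameter \<open>1\<close>, which belongs to \<open>s\<close> itself, is a
    closure point of the open ray.\<close>
  then have "continuous_on (closure {1<..}) (\<lambda>t::real. D (of_real t * s))"
    by simp
  then have "D (of_real 1 * s) = 0"
  proof (rule continuous_constant_on_closure)
    show "D (of_real t * s) = 0" if "t \<in> {1<..}" for t
      using that by (intro D_S ray_S) simp
  qed simp
  then show ?thesis
    by (simp add: D_def)
qed

text \<open>The formula is claimed where the integral converges absolutely and the principal power
  is the intended one. The second conjunct shows that both provisos hold throughout some right
  half-plane.\<close>

theorem theorem2p2:
  fixes lam1 lam2 lam3 \<alpha> \<beta> \<gamma> \<delta> \<eta> :: complex
  assumes "Re \<alpha> > 0" and "Re \<beta> > 0" and "Re \<gamma> > 0" and "Re \<delta> > 0"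
  defines "f \<equiv> (\<lambda>r::real. complex_of_real r powr (\<delta> - 1)
            * trivariate_ML \<alpha> \<beta> \<gamma> \<delta> \<eta> (lam1 * complex_of_real r powr \<alpha>)
                (lam2 * complex_of_real r powr \<beta>) (lam3 * complex_of_real r powr \<gamma>))"
  defines "g \<equiv> (\<lambda>s::complex. 1 - lam1 / s powr \<alpha> - lam2 / s powr \<beta> - lam3 / s powr \<gamma>)"
  shows "(\<forall>s. Re s > 0 \<longrightarrow> laplace_converges f s \<longrightarrow> principal_power_at g (- \<eta>) s \<longrightarrow>
            laplace_transform f s = 1 / s powr \<delta> * g s powr (- \<eta>))
       \<and> (\<exists>\<sigma>\<ge>0. \<forall>s. Re s > \<sigma> \<longrightarrow> laplace_converges f s \<and> principal_power_at g (- \<eta>) s)"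
proof -
  \<comment> \<open>The slope of a sector containing all four parameters, and hence all their
    combinations with nonnegative coefficients.\<close>
  define M where "M = Max ((\<lambda>a. \<bar>Im a\<bar> / Re a) ` {\<alpha>, \<beta>, \<gamma>, \<delta>})"
  have sector: "\<bar>Im a\<bar> \<le> M * Re a" if "a \<in> {\<alpha>, \<beta>, \<gamma>, \<delta>}" for a
  proof -
    have "\<bar>Im a\<bar> / Re a \<le> M"
      unfolding M_def using that by (intro Max_ge) auto
    moreover have "Re a > 0"
      using that assms by auto
    ultimately show ?thesis
      by (simp add: divide_le_eq)
  qed
  \<comment> \<open>Beyond \<open>X1\<close> the series can be transformed term by term on the real
    axis; beyond \<open>X2\<close>, chosen next, \<open>1 - g\<close> has modulus below 1, so
    \<open>g\<close> stays off the cut.\<close>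
  obtain X1 where "X1 > 0" and X1: "\<And>x. x > X1 \<Longrightarrow>
      norm lam1 * (exp (M\<^sup>2 / 2) / x) powr Re \<alpha> + norm lam2 * (exp (M\<^sup>2 / 2) / x) powr Re \<beta>
      + norm lam3 * (exp (M\<^sup>2 / 2) / x) powr Re \<gamma> < 1"
    using ex_bound_sum_powr_less_one[OF exp_ge_zero[of "M\<^sup>2 / 2"] assms(1-3), of "norm lam1" "norm lam2" "norm lam3"] by blast
  obtain X2 where "X2 > 0" and X2: "\<And>x. x > X2 \<Longrightarrow>
      norm lam1 * (exp (M * pi) / x) powr Re \<alpha> + norm lam2 * (exp (M * pi) / x) powr Re \<beta>
      + norm lam3 * (exp (M * pi) / x) powr Re \<gamma> < 1"
    using ex_bound_sum_powr_less_one[OF exp_ge_zero[of "M * pi"] assms(1-3), of "norm lam1" "norm lam2" "norm lam3"] by blast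
  define \<sigma> where "\<sigma> = max X1 X2"
  have "\<sigma> > 0"
    using \<open>X1 > 0\<close> by (simp add: \<sigma>_def)
  have real_axis: "laplace_converges f (of_real x)"
      "laplace_transform f (of_real x) = 1 / of_real x powr \<delta> * g (of_real x) powr (- \<eta>)" if "x > \<sigma>" for x
    using laplace_trivariate_ML_of_real[of \<alpha> \<beta> \<gamma> \<delta> M x lam1 lam2 lam3 \<eta>] assms(1-4) sector X1[of x] that \<open>\<sigma> > 0\<close>
    unfolding f_def g_def \<sigma>_def by auto
  have far: "g s \<notin> \<real>\<^sub>\<le>\<^sub>0" if "Re s > \<sigma>" for s
  proof (rule norm_less_one_imp_not_nonpos_Reals)
    have s: "norm s > X2" "s \<noteq> 0"
      using that complex_Re_le_cmod[of s] \<open>\<sigma> > 0\<close> by (auto simp: \<sigma>_def)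
    have "norm (1 - g s) = norm (lam1 / s powr \<alpha> + lam2 / s powr \<beta> + lam3 / s powr \<gamma>)"
      by (simp add: g_def add.assoc)
    also have "\<dots> \<le> norm (lam1 / s powr \<alpha>) + norm (lam2 / s powr \<beta>) + norm (lam3 / s powr \<gamma>)"
      by (intro norm_triangle_mono norm_triangle_ineq order.refl)
    also have "\<dots> < 1"
      using norm_divide_powr_le[OF s(2) _ sector[of \<alpha>], of lam1] norm_divide_powr_le[OF s(2) _ sector[of \<beta>], of lam2]
        norm_divide_powr_le[OF s(2) _ sector[of \<gamma>], of lam3] X2[OF s(1)] assms(1-3) by simp
    finally show "norm (1 - g s) < 1" .
  qed
  have g_hol: "g holomorphic_on {z. 0 < Re z}"
    unfolding g_def by (intro holomorphic_intros) (auto simp: complex_nonpos_Reals_iff)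
  have powr_hol: "(\<lambda>z. 1 / z powr \<delta>) holomorphic_on {z. 0 < Re z}"
    by (intro holomorphic_intros) (auto simp: complex_nonpos_Reals_iff)
  have "laplace_transform f s = 1 / s powr \<delta> * g s powr (- \<eta>)"
    if s: "Re s > 0" and conv: "laplace_converges f s" and principal: "principal_power_at g (- \<eta>) s" for s
  proof -
    define m where "m = max \<sigma> (Re s)"
    have m: "m \<ge> \<sigma>" "m \<ge> Re s" "m > 0"
      using s by (auto simp: m_def)
    have half_plane: "open {z. Re s < Re z}" "connected {z. Re s < Re z}"
      by (auto intro: convex_connected simp: open_halfspace_Re_gt convex_halfspace_Re_gt)
    have ray: "Re s < Re (of_real t * s)" if "t > 1" for t
      using s that by simp
    show ?thesis
    \<comment> \<open>For integer exponents the cut does not matter and the whole half-plane to the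
      right of \<open>s\<close> serves as domain. Otherwise the domain must avoid the points where
      \<open>g\<close> meets the cut.\<close>
    proof (cases "- \<eta> \<in> \<int> \<and> g s \<noteq> 0")
      case True
      then obtain n where n: "- \<eta> = of_int n"
        by (blast elim: Ints_cases)
      have real_power: "laplace_transform f (of_real x) = 1 / of_real x powr \<delta> * g (of_real x) powi n"
          "g (of_real x) \<noteq> 0" if "x > m" for x
      proof -
        have "g (of_real x) \<notin> \<real>\<^sub>\<le>\<^sub>0"
          using that m by (intro far) simp
        then show "g (of_real x) \<noteq> 0" by auto
        then show "laplace_transform f (of_real x) = 1 / of_real x powr \<delta> * g (of_real x) powi n"
          using that m by (subst real_axis(2)) (auto simp: n complex_powr_of_int)
      qed
      have "laplace_transform f s = 1 / s powr \<delta> * g s powi n"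
      proof (cases "n \<ge> 0")
        case True
        have "laplace_transform f s * 1 = 1 / s powr \<delta> * g s ^ nat n"
        proof (rule laplace_transform_identity_ray[OF conv s half_plane order.refl, of m])
          show "(\<lambda>z. 1 / z powr \<delta> * g z ^ nat n) holomorphic_on {z. 0 < Re z}"
            by (intro holomorphic_intros g_hol powr_hol)
          show "(\<lambda>z. 1 :: complex) holomorphic_on {z. 0 < Re z}"
            by (rule holomorphic_on_const)
        qed (use s m True real_power ray in \<open>auto simp: power_int_def\<close>)
        then show ?thesis
          using True by (simp add: power_int_def)
      next
        case False
        \<comment> \<open>\<open>g\<close> may vanish in the half-plane, so its negative power is moved to the left-hand side.\<close>
        have "laplace_transform f s * g s ^ nat (- n) = 1 / s powr \<delta>"
        proof (rule laplace_transform_identity_ray[OF conv s half_plane order.refl, of m])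
          show "(\<lambda>z. g z ^ nat (- n)) holomorphic_on {z. 0 < Re z}"
            by (intro holomorphic_intros g_hol)
        qed (use s m False real_power ray powr_hol in \<open>auto simp: power_int_def power_inverse divide_simps mult_ac\<close>)
        then show ?thesis
          using False True by (auto simp: power_int_def power_inverse divide_simps mult_ac)
      qed
      then show ?thesis
        using True by (simp add: n complex_powr_of_int)
    next
      case False
      then have cut: "g (of_real t * s) \<notin> \<real>\<^sub>\<le>\<^sub>0" if "t \<ge> 1" for t
        using principal that by (auto simp: principal_power_at_def)
      \<comment> \<open>On \<open>T\<close> the right-hand side is holomorphic, on
        \<open>\<Omega>\<close> the transform is as well. The point \<open>s\<close> lies in
        \<open>T\<close> but only on the boundary line of the half-plane defining
        \<open>\<Omega>\<close>.\<close>
      define T where "T = {z. 0 < Re z} \<inter> g -` (- \<real>\<^sub>\<le>\<^sub>0)"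
      define \<Omega> where "\<Omega> = T \<inter> {z. Re s < Re z}"
      define W where "W = {z. m < Re z}"
      define R where "R = (\<lambda>t. complex_of_real t * s) ` {1<..}"
      \<comment> \<open>\<open>\<Omega>\<close> may be disconnected, so the identity theorem is
        applied on the component of the far half-plane \<open>W\<close>. The ray \<open>R\<close>
        lies in it because it avoids the cut and meets \<open>W\<close>.\<close>
      define S where "S = connected_component_set \<Omega> (of_real (m + 1))"
      have "open T"
        unfolding T_def using holomorphic_on_imp_continuous_on[OF g_hol]
        by (intro continuous_open_preimage) (auto simp: open_halfspace_Re_gt open_Compl)
      then have "open \<Omega>"
        unfolding \<Omega>_def by (intro open_Int half_plane)
      have "connected (W \<union> R)"
      proof (rule connected_Un)
        show "connected W"
          unfolding W_def by (intro convex_connected convex_halfspace_Re_gt)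
        show "connected R"
          unfolding R_def by (intro connected_continuous_image continuous_intros connected_Ioi)
        \<comment> \<open>Chosen so that \<open>Re (t * s)\<close> equals
          \<open>m + 1 + 2 * Re s\<close>, which exceeds \<open>m\<close>, while
          \<open>t > 1\<close>.\<close>
        define t where "t = (m + 1) / Re s + 2"
        have "t > 1" "t * Re s = m + 1 + 2 * Re s"
          using s m by (auto simp: t_def field_simps intro!: add_pos_pos)
        then have "of_real t * s \<in> W \<inter> R"
          using s by (auto simp: W_def R_def)
        then show "W \<inter> R \<noteq> {}" by blast
      qed
      moreover have "W \<union> R \<subseteq> \<Omega>"
        using far cut ray s m by (auto simp: W_def R_def \<Omega>_def T_def)
      ultimately have WR: "W \<union> R \<subseteq> S"
        unfolding S_def by (intro connected_component_maximal) (auto simp: W_def)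
      have "S \<subseteq> \<Omega>"
        unfolding S_def by (rule connected_component_subset)
      have "laplace_transform f s * 1 = 1 / s powr \<delta> * g s powr (- \<eta>)"
      proof (rule laplace_transform_identity_ray[OF conv s, of S m])
        show "open S" "connected S"
          unfolding S_def using \<open>open \<Omega>\<close> by (auto intro: open_connected_component)
        show "(\<lambda>z. 1 / z powr \<delta> * g z powr (- \<eta>)) holomorphic_on T"
          by (intro holomorphic_intros holomorphic_on_subset[OF g_hol] holomorphic_on_subset[OF powr_hol])
             (auto simp: T_def complex_nonpos_Reals_iff)
        show "(\<lambda>z. 1 :: complex) holomorphic_on T"
          by (rule holomorphic_on_const)
        show "insert s S \<subseteq> T"
          using \<open>S \<subseteq> \<Omega>\<close> s cut[of 1] by (auto simp: \<Omega>_def T_def)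
        show "S \<subseteq> {z. Re s < Re z}"
          using \<open>S \<subseteq> \<Omega>\<close> by (auto simp: \<Omega>_def)
        show "complex_of_real x \<in> S" if "x > m" for x
          using WR that by (auto simp: W_def)
        show "complex_of_real t * s \<in> S" if "t > 1" for t
          using WR that by (auto simp: R_def)
        show "laplace_transform f (of_real x) * 1 = 1 / of_real x powr \<delta> * g (of_real x) powr (- \<eta>)"
          if "x > m" for x
          using real_axis(2)[of x] that m by simp
      qed
      then show ?thesis by simp
    qed
  qed
  moreover have "laplace_converges f s \<and> principal_power_at g (- \<eta>) s" if s: "Re s > \<sigma>" for s
  proof
    show "laplace_converges f s"
      using real_axis(1)[OF s] by (rule laplace_converges_mono) simp
    \<comment> \<open>Moving outward along the ray only increases the real part, so the bound far to
      the right covers the entire ray.\<close>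
    have "g (of_real t * s) \<notin> \<real>\<^sub>\<le>\<^sub>0" if "t \<ge> 1" for t
    proof (rule far)
      have "Re s \<le> t * Re s"
        using s that \<open>\<sigma> > 0\<close> by simp
      then show "Re (of_real t * s) > \<sigma>"
        using s by simp
    qed
    then show "principal_power_at g (- \<eta>) s"
      by (simp add: principal_power_at_def)
  qed
  ultimately show ?thesis
    using \<open>\<sigma> > 0\<close> by (intro conjI allI impI exI[of _ \<sigma>]) auto
qed

end
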